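(* Let $\Lambda=\{\lambda_n\}_{n\ge 0}$ be a sequence of real numbers with $\lambda_0=1$, and let $n\ge 1$ be a natural number. Then: (i) $V_n[\Lambda]=\overline{T}_n[\Lambda]\,\overline{T}_{n-1}[\Lambda]\cdots\overline{T}_1[\Lambda]$. (ii) $V_n^{-1}[\Lambda]=\overline{T}_1^{-1}[\Lambda]\,\overline{T}_2^{-1}[\Lambda]\cdots\overline{T}_n^{-1}[\Lambda]$.
   Context: Rows and columns of matrices are indexed from $0$. Given a sequence $\Lambda=\{\lambda_n\}_{n\ge0}$, define numbers $a_{i,j}$ ($i,j\ge 0$) by $a_{i,0}=\lambda_i$ for $i\ge 0$, $a_{i,j}=0$ for $i<j$, and $$a_{i,j}=\sum_{l=j-1}^{i-1}\lambda_{i-1-l}\,a_{l,j-1}\qquad (i\ge j\ge 1).$$ The vertically-recurrent matrix associated with $\Lambda$, of order $(n+1)\times(n+1)$, is $V_n[\Lambda]=[a_{i,j}]_{0\le i,j\le n}$; $V_n^{-1}[\Lambda]$ denotes its inverse. For $k\ge 0$, the lower triangular Toeplitz matrix $T_k[\Lambda]$ is the $(k+1)\times(k+1)$ matrix whose $(i,j)$ entry is $\lambda_{i-j}$ if $i\ge j$ and $0$ if $i<j$. For fixed $n$ and $1\le k\le n$, $\overline{T}_k[\Lambda]$ is the $(n+1)\times(n+1)$ block-diagonal matrix $$\overline{T}_k[\Lambda]=\begin{bmatrix} I_{n-k}&0\\ 0&T_k[\Lambda]\end{bmatrix},$$ where $I_r$ is the identity matrix of order $r$ (so $\overline{T}_n[\Lambda]=T_n[\Lambda]$),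 and $\overline{T}_k^{-1}[\Lambda]$ is its inverse. *)

theory Defs
  imports Complex_Main "Jordan_Normal_Form.Matrix"
begin

fun vr_entry :: "(nat \<Rightarrow> real) \<Rightarrow> nat \<Rightarrow> nat \<Rightarrow> real" where
  "vr_entry \<Lambda> i 0 = \<Lambda> i"
| "vr_entry \<Lambda> i (Suc j) =
     (if i < Suc j then 0 else (\<Sum>l = j..i - 1. \<Lambda> (i - 1 - l) * vr_entry \<Lambda> l j))"

definition V_mat :: "nat \<Rightarrow> (nat \<Rightarrow> real) \<Rightarrow> real mat" where
  "V_mat n \<Lambda> = mat (n + 1) (n + 1) (\<lambda>(i, j). vr_entry \<Lambda> i j)"

definition T_mat :: "nat \<Rightarrow> (nat \<Rightarrow> real) \<Rightarrow> real mat" where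
  "T_mat k \<Lambda> = mat (k + 1) (k + 1) (\<lambda>(i, j). if j \<le> i then \<Lambda> (i - j) else 0)"

text \<open>Only meaningful for \<open>k \<le> n\<close>, when the result has order \<open>n + 1\<close>.\<close>

definition Tbar_mat :: "nat \<Rightarrow> nat \<Rightarrow> (nat \<Rightarrow> real) \<Rightarrow> real mat" where
  "Tbar_mat n k \<Lambda> =
     four_block_mat (1\<^sub>m (n - k)) (0\<^sub>m (n - k) (k + 1))
                    (0\<^sub>m (k + 1) (n - k)) (T_mat k \<Lambda>)"

text \<open>The type \<open>mat\<close> is not a \<open>monoid_mult\<close> (the unit depends on the order), so
  \<open>prod_list\<close> is unavailable for the ordered product \<open>A\<^sub>1 * (A\<^sub>2 * \<dots>)\<close> of matrices of order \<open>N\<close>.\<close>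

definition mat_prod :: "nat \<Rightarrow> real mat list \<Rightarrow> real mat" where
  "mat_prod N As = foldr (*) As (1\<^sub>m N)"

text \<open>The two-sided inverse in the ring of matrices of order \<open>N\<close>; it is unspecified for a
  matrix that is not invertible.\<close>

definition mat_inv :: "nat \<Rightarrow> real mat \<Rightarrow> real mat" where
  "mat_inv N A = inv\<^bsub>ring_mat TYPE(real) N ()\<^esub> A"

end

theory Submission
  imports Defs "Jordan_Normal_Form.Determinant"
begin

text \<open>
  Column \<open>0\<close> of \<open>V\<^sub>k\<close> is column \<open>0\<close> of the Toeplitz matrix \<open>T\<^sub>k\<close>, and the recurrence says that
  column \<open>j + 1\<close> is \<open>T\<^sub>k\<close> applied to column \<open>j\<close> shifted down by one.  Hence
  \<open>V\<^sub>k = T\<^sub>k (1 \<oplus> V\<^sub>k\<^sub>-\<^sub>1)\<close>, where the Toeplitz coefficients may be summed from \<open>0\<close> because \<open>V\<close> is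
  lower triangular.  Padding with identity blocks and iterating gives the factorisation; the
  factors are lower unitriangular, so their product can be inverted factor by factor.
\<close>

text \<open>Matrices of a fixed order form only a monoid under multiplication, so the reversal law
  for inverses is stated for its units. Uniqueness of inverses reduces it to cancelling the inner
  pair on each side.\<close>

lemma (in monoid) inv_mult_Units:
  assumes x: "x \<in> Units G" and y: "y \<in> Units G"
  shows "inv (x \<otimes> y) = inv y \<otimes> inv x"
proof (rule inv_unique'[symmetric])
  have xc: "x \<in> carrier G" "inv x \<in> carrier G" and yc: "y \<in> carrier G" "inv y \<in> carrier G"
    using x y by auto
  then show "x \<otimes> y \<in> carrier G" "inv y \<otimes> inv x \<in> carrier G"
    by auto
  have "x \<otimes> y \<otimes> (inv y \<otimes> inv x) = x \<otimes> (y \<otimes> inv y) \<otimes> inv x"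
    using xc yc by (simp add: m_assoc del: Units_r_inv)
  then show "x \<otimes> y \<otimes> (inv y \<otimes> inv x) = \<one>"
    using x y xc by simp
  have "inv y \<otimes> inv x \<otimes> (x \<otimes> y) = inv y \<otimes> (inv x \<otimes> x) \<otimes> y"
    using xc yc by (simp add: m_assoc del: Units_l_inv)
  then show "inv y \<otimes> inv x \<otimes> (x \<otimes> y) = \<one>"
    using x y yc by simp
qed

lemma index_T_mat [simp]:
  "i < Suc k \<Longrightarrow> j < Suc k \<Longrightarrow> T_mat k \<Lambda> $$ (i, j) = (if j \<le> i then \<Lambda> (i - j) else 0)"
  by (simp add: T_mat_def)

lemma T_mat_carrier [simp, intro]: "T_mat k \<Lambda> \<in> carrier_mat (Suc k) (Suc k)"
  by (simp add: T_mat_def)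

lemma dim_T_mat [simp]: "dim_row (T_mat k \<Lambda>) = Suc k" "dim_col (T_mat k \<Lambda>) = Suc k"
  by (simp_all add: T_mat_def)

lemma V_mat_carrier [simp, intro]: "V_mat k \<Lambda> \<in> carrier_mat (Suc k) (Suc k)"
  by (simp add: V_mat_def)

lemma Tbar_mat_carrier:
  assumes "k \<le> n"
  shows "Tbar_mat n k \<Lambda> \<in> carrier_mat (n + 1) (n + 1)"
proof -
  have "Tbar_mat n k \<Lambda> \<in> carrier_mat (n - k + (k + 1)) (n - k + (k + 1))"
    unfolding Tbar_mat_def by (rule four_block_carrier_mat) auto
  with assms show ?thesis by simp
qed

lemma dim_V_mat [simp]: "dim_row (V_mat k \<Lambda>) = Suc k" "dim_col (V_mat k \<Lambda>) = Suc k"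
  by (simp_all add: V_mat_def)

lemma mat_prod_carrier:
  "set As \<subseteq> carrier_mat N N \<Longrightarrow> mat_prod N As \<in> carrier_mat N N"
  by (induction As) (auto simp: mat_prod_def)

lemma mat_prod_append:
  assumes "set As \<subseteq> carrier_mat N N" "set Bs \<subseteq> carrier_mat N N"
  shows "mat_prod N (As @ Bs) = mat_prod N As * mat_prod N Bs"
  using assms
proof (induction As)
  case Nil
  then show ?case using mat_prod_carrier[of Bs N] by (simp add: mat_prod_def)
next
  case (Cons A As)
  then show ?case
    using mat_prod_carrier[of Bs N] mat_prod_carrier[of As N]
    by (simp add: mat_prod_def assoc_mult_mat[of _ N N _ N _ N])
qed

text \<open>Since \<open>mat_inv\<close> is unspecified off the units, the theorem also asserts
  invertibility. This turns ring-theoretic units into that form.\<close>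

lemma Units_ring_mat_imp_invertible_mat:
  assumes "A \<in> Units (ring_mat TYPE('a :: semiring_1) N b)"
  shows "invertible_mat A"
  using assms unfolding Units_def invertible_mat_def inverts_mat_def ring_mat_def
  by auto

text \<open>The two conjuncts are proved together: inverting \<open>A * mat_prod N As\<close> by the
  reversal law requires the tail product to be a unit already.\<close>

lemma mat_inv_mat_prod:
  assumes "set As \<subseteq> Units (ring_mat TYPE(real) N ())"
  shows "mat_prod N As \<in> Units (ring_mat TYPE(real) N ())
    \<and> mat_inv N (mat_prod N As) = mat_prod N (map (mat_inv N) (rev As))"
  using assms
proof (induction As)
  interpret R: ring "ring_mat TYPE(real) N ()" by (rule ring_mat)
  case Nil
  then show ?case
    using R.inv_one R.Units_one_closed by (simp add: mat_prod_def mat_inv_def ring_mat_def)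
next
  interpret R: ring "ring_mat TYPE(real) N ()" by (rule ring_mat)
  have mult: "x \<otimes>\<^bsub>ring_mat TYPE(real) N ()\<^esub> y = x * y" for x y
    by (simp add: ring_mat_def)
  have inv_carrier: "A \<in> Units (ring_mat TYPE(real) N ()) \<Longrightarrow> mat_inv N A \<in> carrier_mat N N" for A
    using R.Units_inv_closed[of A] unfolding mat_inv_def by (simp add: ring_mat_def)
  case (Cons A As)
  have A: "A \<in> Units (ring_mat TYPE(real) N ())"
    and P: "mat_prod N As \<in> Units (ring_mat TYPE(real) N ())"
    and IH: "mat_inv N (mat_prod N As) = mat_prod N (map (mat_inv N) (rev As))"
    using Cons by auto
  have "mat_prod N (A # As) = A * mat_prod N As"
    by (simp add: mat_prod_def)
  moreover have "A * mat_prod N As \<in> Units (ring_mat TYPE(real) N ())"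
    using R.Units_m_closed[OF A P] by (simp add: mult)
  moreover have "mat_inv N (A * mat_prod N As) = mat_inv N (mat_prod N As) * mat_inv N A"
    using R.inv_mult_Units[OF A P] by (simp add: mat_inv_def mult)
  moreover have "mat_prod N (map (mat_inv N) (rev (A # As)))
      = mat_prod N (map (mat_inv N) (rev As)) * mat_inv N A"
    using Cons.prems inv_carrier
    by (subst rev.simps, subst map_append, subst mat_prod_append)
      (auto simp: mat_prod_def subset_iff right_mult_one_mat[OF inv_carrier[OF A]])
  ultimately show ?case using IH by simp
qed

lemma vr_entry_upper_zero: "i < j \<Longrightarrow> vr_entry \<Lambda> i j = 0"
  by (cases j) auto

lemma V_mat_Suc:
  "V_mat (Suc k) \<Lambda> = T_mat (Suc k) \<Lambda> *
     four_block_mat (1\<^sub>m 1) (0\<^sub>m 1 (k + 1)) (0\<^sub>m (k + 1) 1) (V_mat k \<Lambda>)"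
    (is "_ = _ * ?B")
proof (rule eq_matI)
  have B: "?B \<in> carrier_mat (1 + (k + 1)) (1 + (k + 1))"
    by (rule four_block_carrier_mat) auto
  then show "dim_row (V_mat (Suc k) \<Lambda>) = dim_row (T_mat (Suc k) \<Lambda> * ?B)"
    "dim_col (V_mat (Suc k) \<Lambda>) = dim_col (T_mat (Suc k) \<Lambda> * ?B)"
    by (auto simp: V_mat_def T_mat_def)
  fix i j
  assume "i < dim_row (T_mat (Suc k) \<Lambda> * ?B)" "j < dim_col (T_mat (Suc k) \<Lambda> * ?B)"
  then have i: "i < k + 2" and j: "j < k + 2"
    using B by (auto simp: T_mat_def)
  have "(T_mat (Suc k) \<Lambda> * ?B) $$ (i, j)
      = (\<Sum>l = 0..<k + 2. T_mat (Suc k) \<Lambda> $$ (i, l) * ?B $$ (l, j))"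
    using i j by (simp add: scalar_prod_def del: sum.op_ivl_Suc)
  \<comment> \<open>The case distinctions encode the blocks: index 0 is the border with its single
    1, and a successor index points into \<open>V_mat k \<Lambda>\<close>.\<close>
  also have "\<dots> = (\<Sum>l = 0..<k + 2. (if l \<le> i then \<Lambda> (i - l) else 0) *
      (case l of 0 \<Rightarrow> if j = 0 then 1 else 0
         | Suc l' \<Rightarrow> (case j of 0 \<Rightarrow> 0 | Suc j' \<Rightarrow> vr_entry \<Lambda> l' j')))"
    using i j by (intro sum.cong refl) (auto simp: V_mat_def split: nat.splits)
  also have "\<dots> = vr_entry \<Lambda> i j"
  proof (cases j)
    case 0
    have "(\<Sum>l = 0..<Suc (k + 1). (if l \<le> i then \<Lambda> (i - l) else 0) *
      (case l of 0 \<Rightarrow> (1::real) | Suc l' \<Rightarrow> 0)) = \<Lambda> i"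
      by (subst sum.atLeast0_lessThan_Suc_shift) simp
    then show ?thesis using 0 by (simp del: sum.op_ivl_Suc cong: nat.case_cong)
  next
    case (Suc j')
    \<comment> \<open>The border term l = 0 vanishes. Shifting the others down by one turns l \<le>
      i into l < i and i - l into the i - 1 - l of the recurrence.\<close>
    have "(\<Sum>l = 0..<Suc (k + 1). (if l \<le> i then \<Lambda> (i - l) else 0) *
      (case l of 0 \<Rightarrow> 0 | Suc l' \<Rightarrow> vr_entry \<Lambda> l' j'))
      = (\<Sum>l = 0..<k + 1. if l < i then \<Lambda> (i - 1 - l) * vr_entry \<Lambda> l j' else 0)"
      by (subst sum.atLeast0_lessThan_Suc_shift) (auto intro!: sum.cong)
    \<comment> \<open>Terms with l < j' vanish by lower triangularity, which leaves the range of the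
      recurrence.\<close>
    also have "\<dots> = (\<Sum>l \<in> {l. j' \<le> l \<and> l < i}. \<Lambda> (i - 1 - l) * vr_entry \<Lambda> l j')"
      using i by (intro sum.mono_neutral_cong_right) (auto, meson leI vr_entry_upper_zero)
    also have "\<dots> = vr_entry \<Lambda> i (Suc j')"
      \<comment> \<open>The case i = 0 is separate because there i - 1 truncates to 0; the index set
        is empty and the entry lies above the diagonal.\<close>
      by (cases i) (auto intro!: sum.cong sum.neutral simp: vr_entry_upper_zero)
    finally show ?thesis using Suc by (simp del: sum.op_ivl_Suc vr_entry.simps cong: nat.case_cong)
  qed
  finally show "V_mat (Suc k) \<Lambda> $$ (i, j) = (T_mat (Suc k) \<Lambda> * ?B) $$ (i, j)"
    using i j by (simp add: V_mat_def)
qed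

text \<open>Regrouping the direct sum moves one diagonal 1 from the padding into the lower block, so
  that the partial product and the next factor are split at the same place.\<close>

lemma four_block_mat_one_shift:
  assumes "A \<in> carrier_mat r r"
  shows "four_block_mat (1\<^sub>m (m + 1)) (0\<^sub>m (m + 1) r) (0\<^sub>m r (m + 1)) A
    = four_block_mat (1\<^sub>m m) (0\<^sub>m m (1 + r)) (0\<^sub>m (1 + r) m)
        (four_block_mat (1\<^sub>m 1) (0\<^sub>m 1 r) (0\<^sub>m r 1) A)"
  using assms by (intro eq_matI) auto

lemma mult_four_block_mat_one:
  assumes "A \<in> carrier_mat r r" "B \<in> carrier_mat r r"
  shows "four_block_mat (1\<^sub>m m) (0\<^sub>m m r) (0\<^sub>m r m) A * four_block_mat (1\<^sub>m m) (0\<^sub>m m r) (0\<^sub>m r m) B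
    = four_block_mat (1\<^sub>m m) (0\<^sub>m m r) (0\<^sub>m r m) (A * B :: 'a :: semiring_1 mat)"
  using assms by (subst mult_four_block_mat[of _ m m _ r _ r]) auto

text \<open>The factorisation is generalised to partial products so that induction can start from
  the empty product.\<close>

lemma mat_prod_Tbar_mat:
  assumes "\<Lambda> 0 = 1" "k \<le> n"
  shows "mat_prod (n + 1) (map (\<lambda>k. Tbar_mat n k \<Lambda>) (rev [1..<k + 1]))
    = four_block_mat (1\<^sub>m (n - k)) (0\<^sub>m (n - k) (k + 1)) (0\<^sub>m (k + 1) (n - k)) (V_mat k \<Lambda>)"
  using assms(2)
proof (induction k)
  case 0
  \<comment> \<open>The single entry is \<Lambda> 0; the normalisation to 1 makes the padded block
    the full identity.\<close>
  have "V_mat 0 \<Lambda> = 1\<^sub>m 1"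
    using assms(1) by (intro eq_matI) (auto simp: V_mat_def)
  then show ?case by (simp add: mat_prod_def)
next
  case (Suc k)
  let ?B = "four_block_mat (1\<^sub>m 1) (0\<^sub>m 1 (k + 1)) (0\<^sub>m (k + 1) 1) (V_mat k \<Lambda>)"
  let ?m = "n - Suc k"
  have B: "?B \<in> carrier_mat (1 + (k + 1)) (1 + (k + 1))"
    by (rule four_block_carrier_mat) auto
  have m: "n - k = ?m + 1" using Suc.prems by simp
  have "mat_prod (n + 1) (map (\<lambda>k. Tbar_mat n k \<Lambda>) (rev [1..<Suc k + 1]))
    = Tbar_mat n (Suc k) \<Lambda> * mat_prod (n + 1) (map (\<lambda>k. Tbar_mat n k \<Lambda>) (rev [1..<k + 1]))"
    by (simp add: mat_prod_def)
  also have "\<dots> = Tbar_mat n (Suc k) \<Lambda> *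
     four_block_mat (1\<^sub>m ?m) (0\<^sub>m ?m (1 + (k + 1))) (0\<^sub>m (1 + (k + 1)) ?m) ?B"
    using Suc by (subst four_block_mat_one_shift[symmetric]) (auto simp: m)
  also have "\<dots> = four_block_mat (1\<^sub>m ?m) (0\<^sub>m ?m (1 + (k + 1))) (0\<^sub>m (1 + (k + 1)) ?m)
     (T_mat (Suc k) \<Lambda> * ?B)"
    using mult_four_block_mat_one[OF _ B, of "T_mat (Suc k) \<Lambda>" ?m] T_mat_carrier[of "Suc k" \<Lambda>]
    by (simp add: Tbar_mat_def)
  finally show ?case by (simp add: V_mat_Suc)
qed

text \<open>The matrix is lower triangular with unit diagonal, so its determinant is 1, and a
  nonzero determinant over a field gives a unit.\<close>

lemma Tbar_mat_Units:
  assumes "\<Lambda> 0 = 1" "k \<le> n"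
  shows "Tbar_mat n k \<Lambda> \<in> Units (ring_mat TYPE(real) (n + 1) ())"
proof -
  note C = Tbar_mat_carrier[OF assms(2), of \<Lambda>]
  have entry: "Tbar_mat n k \<Lambda> $$ (i, j) = (if i = j then 1 else 0)"
    if "i \<le> j" "j < n + 1" for i j
    using that assms by (auto simp: Tbar_mat_def)
  have "det (Tbar_mat n k \<Lambda>) = prod_list (diag_mat (Tbar_mat n k \<Lambda>))"
    using C entry by (intro det_lower_triangular[of "n + 1"]) auto
  also have "diag_mat (Tbar_mat n k \<Lambda>) = map (\<lambda>_. 1) [0..<n + 1]"
    using C entry by (auto simp: diag_mat_def)
  finally have "det (Tbar_mat n k \<Lambda>) = 1"
    by (simp add: map_replicate_const)
  then show ?thesis
    using det_non_zero_imp_unit[OF C] by simp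
qed

theorem corollary2p5:
  fixes \<Lambda> :: "nat \<Rightarrow> real" and n :: nat
  assumes "\<Lambda> 0 = 1" and "n \<ge> 1"
  shows "V_mat n \<Lambda> = mat_prod (n + 1) (map (\<lambda>k. Tbar_mat n k \<Lambda>) (rev [1..<n + 1]))
    \<and> (invertible_mat (V_mat n \<Lambda>)
       \<and> (\<forall>k\<in>{1..n}. invertible_mat (Tbar_mat n k \<Lambda>))
       \<and> mat_inv (n + 1) (V_mat n \<Lambda>)
           = mat_prod (n + 1) (map (\<lambda>k. mat_inv (n + 1) (Tbar_mat n k \<Lambda>)) [1..<n + 1]))"
proof -
  let ?As = "map (\<lambda>k. Tbar_mat n k \<Lambda>) (rev [1..<n + 1])"
  \<comment> \<open>For k = n the padding in \<open>mat_prod_Tbar_mat\<close> has order 0.\<close>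
  have "four_block_mat (1\<^sub>m 0) (0\<^sub>m 0 (n + 1)) (0\<^sub>m (n + 1) 0) (V_mat n \<Lambda>) = V_mat n \<Lambda>"
    by (intro eq_matI) (auto simp: V_mat_def)
  then have V: "V_mat n \<Lambda> = mat_prod (n + 1) ?As"
    using mat_prod_Tbar_mat[of \<Lambda> n n] assms by simp
  have U: "set ?As \<subseteq> Units (ring_mat TYPE(real) (n + 1) ())"
    using Tbar_mat_Units assms by auto
  \<comment> \<open>The factors of V descend in k, so the reversal caused by inversion puts them in
    ascending order.\<close>
  have "map (mat_inv (n + 1)) (rev ?As) = map (\<lambda>k. mat_inv (n + 1) (Tbar_mat n k \<Lambda>)) [1..<n + 1]"
    by (simp add: rev_map)
  then have inv: "mat_inv (n + 1) (V_mat n \<Lambda>)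
      = mat_prod (n + 1) (map (\<lambda>k. mat_inv (n + 1) (Tbar_mat n k \<Lambda>)) [1..<n + 1])"
    using mat_inv_mat_prod[OF U] V by metis
  have "invertible_mat (V_mat n \<Lambda>)"
    using mat_inv_mat_prod[OF U] V Units_ring_mat_imp_invertible_mat by metis
  moreover have "\<forall>k\<in>{1..n}. invertible_mat (Tbar_mat n k \<Lambda>)"
    using Units_ring_mat_imp_invertible_mat Tbar_mat_Units[of \<Lambda>, OF assms(1)]
    by (meson atLeastAtMost_iff)
  ultimately show ?thesis using V inv by blast
qed

end
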